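(* For fixed $k\in\mathbb Z_+$, let $h=\mathbf 1_{[k,\infty)}$. Let $f=f_h$ be the solution of the Stein equation $$\lambda f(j+1)-jf(j)=h(j)-\mathrm{Pn}(\lambda)\{h\},\qquad j\ge0,$$ where one sets $f(0)=f(1)$ and $f(j)=0$ for $j<0$. Then $f$ has the following properties: (i) $\|f\|:=\sup_{i\in\mathbb Z_+}|f(i)|=C_0(\lambda,k)\,\mathrm{Pn}(\lambda)\{h\}$, where $C_0(\lambda,k):=\dfrac{F(k-1)}{k\pi_k}$; (ii) $\Delta f(i)$ is negative and decreasing in $i\le k-1$; and positive and decreasing in $i\ge k$; (iii) $\|\Delta f\|_{k-}:=\sup_{i\le k-1}|\Delta f(i)|=C_{1-}(\lambda,k)\,\mathrm{Pn}(\lambda)\{h\}$ and $\|\Delta f\|_{k+}:=\sup_{i\ge k}|\Delta f(i)|=C_{1+}(\lambda,k)\,\mathrm{Pn}(\lambda)\{h\}$, where $$C_{1-}(\lambda,k):=\frac{F(k-1)}{k\pi_k}\left(1-\frac{F(k-2)}{F(k-1)}\cdot\frac{\lambda}{k-1}\right),\qquad C_{1+}(\lambda,k):=\frac{F(k-1)}{k\pi_k}\left(1-\frac{\overline F(k+1)}{\overline F(k)}\cdot\frac{k}{\lambda}\right);$$ (iv) $\|\Delta f\|:=\sup_{i\in\mathbb Z_+}|\Delta f(i)|=C_1(\lambda,k)\,\mathrm{Pn}(\lambda)\{h\}$ and $\|\Delta^2f\|:=\sup_{i\in\mathbb Z_+}|\Delta^2f(i)|=C_2(\lambda,k)\,\mathrm{Pn}(\lambda)\{h\}$,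 where $$C_1(\lambda,k):=\frac{F(k-1)}{k\pi_k}\left\{1-\min\left(\frac{F(k-2)}{F(k-1)}\cdot\frac{\lambda}{k-1},\ \frac{\overline F(k+1)}{\overline F(k)}\cdot\frac{k}{\lambda}\right)\right\},$$ $$C_2(\lambda,k):=\frac{F(k-1)}{k\pi_k}\left(2-\frac{F(k-2)}{F(k-1)}\cdot\frac{\lambda}{k-1}-\frac{\overline F(k+1)}{\overline F(k)}\cdot\frac{k}{\lambda}\right).$$
   Context: $\mathbb Z_+=\{0,1,2,\dots\}$; $\mathrm{Pn}(\lambda)$ is the Poisson distribution with mean $\lambda$; $\pi_j=\mathrm{Pn}(\lambda)(\{j\})$. For $Y\sim\mathrm{Pn}(\lambda)$, $\mathrm{Pn}(\lambda)\{h\}=\mathbb E h(Y)$, $F(j)=\mathbb P(Y\le j)$ and $\overline F(j)=\mathbb P(Y\ge j)$. $\Delta f(i)=f(i+1)-f(i)$ and $\Delta^2f=\Delta(\Delta f)$. The value $f(0)$ plays no role in the Stein equation.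
   Formalization: Indices i are in Z_+. As f(0)=f(1) gives Δf(0)=0, Δf(i)<0 is claimed only for 1≤i≤k-1 (≤0 at i=0). For k=0, f=0 on Z_+: (ii) holds weakly for i≥k and the 0/0 in C_0 is read as 0. For k=1 the undefined F(k-2)/F(k-1)·λ/(k-1) is read as 1. *)

theory Defs
  imports "HOL-Probability.Probability"
begin

definition fwd_diff :: "(int \<Rightarrow> real) \<Rightarrow> int \<Rightarrow> real" where
  "fwd_diff g i = g (i + 1) - g i"

text \<open>The supremum is taken in \<open>[0, \<infinity>]\<close>: it is \<open>\<infinity>\<close> for an unbounded function, and the
  \<open>max 0\<close> only matters for empty \<open>A\<close>, where the value is 0.\<close>

definition sup_norm_on :: "int set \<Rightarrow> (int \<Rightarrow> real) \<Rightarrow> ereal" where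
  "sup_norm_on A g = max 0 (SUP i\<in>A. ereal \<bar>g i\<bar>)"

definition poisson_expect :: "real \<Rightarrow> (nat \<Rightarrow> real) \<Rightarrow> real" where
  "poisson_expect lam h = measure_pmf.expectation (poisson_pmf lam) h"

text \<open>The arguments of \<open>F\<close> and of the upper tail are integers because \<open>F (k - 1)\<close> and \<open>F (k - 2)\<close>
  occur with \<open>k - 1 < 0\<close> or \<open>k - 2 < 0\<close>, where \<open>F\<close> vanishes. Both probabilities include the
  end point \<open>j\<close>.\<close>

definition poisson_F :: "real \<Rightarrow> int \<Rightarrow> real" where
  "poisson_F lam j = measure_pmf.prob (poisson_pmf lam) {y. int y \<le> j}"

definition poisson_Fbar :: "real \<Rightarrow> int \<Rightarrow> real" where
  "poisson_Fbar lam j = measure_pmf.prob (poisson_pmf lam) {y. int y \<ge> j}"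

definition stein_solution :: "real \<Rightarrow> (nat \<Rightarrow> real) \<Rightarrow> (int \<Rightarrow> real) \<Rightarrow> bool" where
  "stein_solution lam h f \<longleftrightarrow>
     (\<forall>j::nat. lam * f (int j + 1) - real j * f (int j) = h j - poisson_expect lam h) \<and>
     f 0 = f 1 \<and> (\<forall>j<0. f j = 0)"

text \<open>For \<open>k = 0\<close> the quotient is \<open>0 / 0\<close>; it evaluates to 0, in agreement with \<open>f = 0\<close>, which is
  the Stein solution for the constant function \<open>h = 1\<close>.\<close>

definition C0 :: "real \<Rightarrow> nat \<Rightarrow> real" where
  "C0 lam k = poisson_F lam (int k - 1) / (real k * pmf (poisson_pmf lam) k)"

text \<open>The expression \<open>F (k - 2) / F (k - 1) * (lam / (k - 1))\<close> equals \<open>f (k - 1) / f k\<close> for \<open>k \<ge> 2\<close>.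
  For \<open>k = 1\<close> it has the form \<open>0 / 0\<close> and is read as \<open>f 0 / f 1 = 1\<close>, the value dictated by the
  convention \<open>f 0 = f 1\<close>. (For \<open>k = 0\<close> its value is irrelevant, since \<open>C0 lam 0 = 0\<close>.)\<close>

definition ratio_minus :: "real \<Rightarrow> nat \<Rightarrow> real" where
  "ratio_minus lam k =
     (if k = 1 then 1
      else poisson_F lam (int k - 2) / poisson_F lam (int k - 1) * (lam / (real k - 1)))"

definition ratio_plus :: "real \<Rightarrow> nat \<Rightarrow> real" where
  "ratio_plus lam k = poisson_Fbar lam (int k + 1) / poisson_Fbar lam (int k) * (real k / lam)"

definition C1_minus :: "real \<Rightarrow> nat \<Rightarrow> real" where
  "C1_minus lam k = C0 lam k * (1 - ratio_minus lam k)"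

definition C1_plus :: "real \<Rightarrow> nat \<Rightarrow> real" where
  "C1_plus lam k = C0 lam k * (1 - ratio_plus lam k)"

definition C1 :: "real \<Rightarrow> nat \<Rightarrow> real" where
  "C1 lam k = C0 lam k * (1 - min (ratio_minus lam k) (ratio_plus lam k))"

definition C2 :: "real \<Rightarrow> nat \<Rightarrow> real" where
  "C2 lam k = C0 lam k * (2 - ratio_minus lam k - ratio_plus lam k)"

end

theory Submission
  imports Defs
begin

text \<open>
  Multiplying the Stein equation by \<open>\<pi>\<^sub>j\<close> and summing gives
  \<open>i \<pi>\<^sub>i f i = (\<Sum>m<i. \<pi>\<^sub>m (h m - Pn{h}))\<close>. For \<open>h = 1\<^bsub>[k,\<infinity>)\<^esub>\<close> this is \<open>- Pn{h} F(i - 1)\<close> if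
  \<open>1 \<le> i \<le> k\<close> and \<open>- F(k - 1) P(Y \<ge> i)\<close> if \<open>i \<ge> k\<close>. So everything reduces to two
  quotients: \<open>F(i - 1) / (i \<pi>\<^sub>i)\<close> is strictly increasing and strictly convex in \<open>i\<close>, by induction on
  the recurrence it satisfies, and \<open>P(Y \<ge> i) / (i \<pi>\<^sub>i) = (\<Sum>r. \<lambda>\<^sup>r (i - 1)! / (i + r)!)\<close> is
  strictly decreasing and strictly convex, because every summand is. All suprema are then attained
  at \<open>k - 1\<close> or \<open>k\<close>.
\<close>

section \<open>Monotonicity and suprema on sets of integers, and a factorial identity\<close>

lemma monotone_on_int_stepI:
  fixes g :: "int \<Rightarrow> 'a"
  assumes interval: "\<And>x y z. x \<in> S \<Longrightarrow> z \<in> S \<Longrightarrow> x \<le> y \<Longrightarrow> y \<le> z \<Longrightarrow> y \<in> S"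
    and R: "transp R"
    and step: "\<And>i. i \<in> S \<Longrightarrow> i + 1 \<in> S \<Longrightarrow> R (g i) (g (i + 1))"
  shows "monotone_on S (<) R g"
proof (rule monotone_onI)
  fix x y assume x: "x \<in> S" and y: "y \<in> S" and "x < y"
  from \<open>x < y\<close> have "x + 1 \<le> y" by simp
  then show "R (g x) (g y)" using y
  proof (induction y rule: int_ge_induct)
    case base
    then show ?case using step x by blast
  next
    case (step i)
    then have i: "i \<in> S" using interval[OF x] by simp
    then have "R (g x) (g i)" using step.IH by simp
    moreover have "R (g i) (g (i + 1))" using assms(3) i step.prems by blast
    ultimately show ?case using R by (blast dest: transpD)
  qed
qed

lemma sup_norm_on_eqI:
  assumes "i \<in> A" "\<And>j. j \<in> A \<Longrightarrow> \<bar>g j\<bar> \<le> \<bar>g i\<bar>" "c = \<bar>g i\<bar>"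
  shows "sup_norm_on A g = ereal c"
proof -
  have "(SUP i\<in>A. ereal \<bar>g i\<bar>) = ereal \<bar>g i\<bar>"
    using assms by (intro antisym SUP_least SUP_upper) auto
  then show ?thesis unfolding sup_norm_on_def assms(3) by (simp add: max_def)
qed

lemma sums_pos:
  fixes a :: "nat \<Rightarrow> real"
  assumes "a sums s" "\<And>r. a r > 0"
  shows "s > 0"
  using suminf_pos[of a] assms by (simp add: sums_iff)

text \<open>Over the common denominator the numerator is
  \<open>(n + r + 2) - (n + 1) = r + 1\<close>. Since
  \<open>Suc (Suc n) + r = Suc n + Suc r\<close>, the result has the same shape with
  \<open>Suc r\<close> for \<open>r\<close>, so the identity can be applied a second time.\<close>

lemma fact_quot_diff:
  "(fact n / fact (Suc n + r) :: real) - fact (Suc n) / fact (Suc (Suc n) + r)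
    = real (Suc r) * (fact n / fact (Suc (Suc n) + r))"
proof -
  define a b x :: real where "a = fact n" and "b = fact (Suc n + r)" and "x = real n + real r + 2"
  have "fact (Suc n) = (real n + 1) * a" "fact (Suc (Suc n) + r) = x * b"
    by (simp_all add: a_def b_def x_def algebra_simps)
  moreover have "b > 0" "x > 0" by (simp_all add: b_def x_def)
  then have "a / b - (real n + 1) * a / (x * b) = (x - real n - 1) * (a / (x * b))"
    by (simp add: field_simps)
  ultimately show ?thesis unfolding a_def[symmetric] b_def[symmetric]
    by (simp add: x_def del: fact_Suc)
qed

section \<open>Poisson head sums and the two quotients\<close>

context
  fixes lam :: real
  assumes lam: "lam > 0"
begin

text \<open>This is \<open>F (i - 1)\<close>; with a natural index the empty sum takes the place of
  \<open>F (- 1)\<close>.\<close>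

definition head :: "nat \<Rightarrow> real" where
  "head i = (\<Sum>m<i. pmf (poisson_pmf lam) m)"

text \<open>Both quotients are \<open>0\<close> at \<open>i = 0\<close>, by division by zero; for \<open>lower_quot\<close> this is compatible
  with the recurrence.\<close>

definition lower_quot :: "nat \<Rightarrow> real" where
  "lower_quot i = head i / (real i * pmf (poisson_pmf lam) i)"

definition upper_quot :: "nat \<Rightarrow> real" where
  "upper_quot i = (1 - head i) / (real i * pmf (poisson_pmf lam) i)"

lemma pmf_poisson_pos: "pmf (poisson_pmf lam) i > 0"
  using lam by simp

lemma pmf_poisson_Suc:
  "real (Suc i) * pmf (poisson_pmf lam) (Suc i) = lam * pmf (poisson_pmf lam) i"
  using lam by (simp del: of_nat_Suc)

lemma poisson_F_eq_head: "poisson_F lam (int i - 1) = head i"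
proof -
  have "{y. int y \<le> int i - 1} = {..<i}" by auto
  then show ?thesis unfolding poisson_F_def head_def
    by (simp add: measure_measure_pmf_finite)
qed

lemma poisson_Fbar_eq_head: "poisson_Fbar lam (int i) = 1 - head i"
proof -
  have "{y. int y \<ge> int i} = UNIV - {..<i}" by auto
  then show ?thesis unfolding poisson_Fbar_def head_def
    using measure_pmf.prob_compl[of "{..<i}" "poisson_pmf lam"]
    by (simp add: measure_measure_pmf_finite)
qed

lemma poisson_expect_indicator: "poisson_expect lam (indicator {k..}) = 1 - head k"
proof -
  have "{k..} = {y. int y \<ge> int k}" by auto
  then show ?thesis unfolding poisson_expect_def
    using poisson_Fbar_eq_head[of k] by (simp add: poisson_Fbar_def)
qed

lemma head_0: "head 0 = 0" and head_Suc: "head (Suc i) = head i + pmf (poisson_pmf lam) i"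
  by (simp_all add: head_def)

lemma head_pos: "i > 0 \<Longrightarrow> head i > 0"
  unfolding head_def using pmf_poisson_pos by (intro sum_pos) auto

lemma tail_sums: "(\<lambda>r. pmf (poisson_pmf lam) (r + i)) sums (1 - head i)"
proof -
  have "(\<lambda>n. lam ^ n /\<^sub>R fact n * exp (- lam)) sums (exp lam * exp (- lam))"
    by (intro sums_mult2 exp_converges)
  then have "pmf (poisson_pmf lam) sums 1"
    using lam by (simp add: exp_minus field_simps poisson_pmf.rep_eq)
  then show ?thesis unfolding head_def by (rule sums_split_initial_segment)
qed

lemma head_less_1: "head i < 1"
  using sums_pos[OF tail_sums pmf_poisson_pos, of i] by simp

section \<open>Growth and convexity of the lower quotient\<close>

lemma lower_quot_Suc: "lam * lower_quot (Suc i) = real i * lower_quot i + 1"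
proof -
  have "lam * lower_quot (Suc i) = head (Suc i) / pmf (poisson_pmf lam) i"
    unfolding lower_quot_def pmf_poisson_Suc using lam by simp
  also have "\<dots> = real i * lower_quot i + 1"
    using pmf_poisson_pos[of i] by (cases "i = 0") (auto simp: lower_quot_def head_Suc head_0 field_simps)
  finally show ?thesis .
qed

text \<open>Subtracting consecutive recurrences and splitting \<open>i + 1\<close> into
  \<open>i\<close> and \<open>1\<close> leaves only nonnegative coefficients, so positivity passes
  from one difference to the next.\<close>

lemma lower_quot_diff:
  "lam * (lower_quot (Suc (Suc i)) - lower_quot (Suc i))
    = real i * (lower_quot (Suc i) - lower_quot i) + lower_quot (Suc i)"
  using lower_quot_Suc[of i] lower_quot_Suc[of "Suc i"] by (simp add: algebra_simps)

lemma lower_quot_pos: "lower_quot (Suc i) > 0"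
  unfolding lower_quot_def using head_pos pmf_poisson_pos by simp

lemma lower_quot_less: "lower_quot (Suc i) < lower_quot (Suc (Suc i))"
proof -
  have "lower_quot (Suc (Suc i)) - lower_quot (Suc i) > 0"
  proof (induction i)
    case 0
    \<comment> \<open>The factor \<open>real i\<close> is 0 here, so the conventional value
      \<open>lower_quot 0\<close> drops out.\<close>
    have "lam * (lower_quot (Suc (Suc 0)) - lower_quot (Suc 0)) > 0"
      unfolding lower_quot_diff using lower_quot_pos[of 0] by simp
    then show ?case using lam zero_less_mult_pos by blast
  next
    case (Suc i)
    have "lam * (lower_quot (Suc (Suc (Suc i))) - lower_quot (Suc (Suc i))) > 0"
      unfolding lower_quot_diff[of "Suc i"]
      using Suc lower_quot_pos[of "Suc i"] by (intro add_nonneg_pos mult_nonneg_nonneg) auto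
    then show ?case using lam zero_less_mult_pos by blast
  qed
  then show ?thesis by simp
qed

text \<open>The same mechanism one order higher: the inhomogeneous term is now twice a first
  difference, positive by \<open>lower_quot_less\<close>.\<close>

lemma lower_quot_diff2:
  "lam * (lower_quot (i + 3) - 2 * lower_quot (i + 2) + lower_quot (i + 1))
    = real i * (lower_quot (i + 2) - 2 * lower_quot (i + 1) + lower_quot i)
      + 2 * (lower_quot (i + 2) - lower_quot (i + 1))"
  using lower_quot_diff[of i] lower_quot_diff[of "Suc i"]
  by (simp add: algebra_simps numeral_eq_Suc)

lemma lower_quot_convex: "lower_quot (i + 3) - 2 * lower_quot (i + 2) + lower_quot (i + 1) > 0"
proof (induction i)
  case 0
  have "lam * (lower_quot (0 + 3) - 2 * lower_quot (0 + 2) + lower_quot (0 + 1)) > 0"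
    unfolding lower_quot_diff2 using lower_quot_less[of 0] by (simp add: numeral_eq_Suc)
  then show ?case using lam zero_less_mult_pos by blast
next
  case (Suc i)
  have eq: "i + 3 = Suc i + 2" "i + 2 = Suc i + 1" "i + 1 = Suc i" by simp_all
  have "lam * (lower_quot (Suc i + 3) - 2 * lower_quot (Suc i + 2) + lower_quot (Suc i + 1)) > 0"
    unfolding lower_quot_diff2 using lower_quot_less[of "Suc i"] Suc[unfolded eq]
    by (intro add_nonneg_pos mult_nonneg_nonneg) (auto simp: numeral_eq_Suc)
  then show ?case using lam zero_less_mult_pos by blast
qed

section \<open>Decay and convexity of the upper quotient\<close>

lemma upper_quot_pos: "upper_quot (Suc i) > 0"
  unfolding upper_quot_def using head_less_1 pmf_poisson_pos by simp

text \<open>By \<open>pmf_poisson_Suc\<close> the denominator is \<open>lam\<close> times the weight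
  at \<open>n\<close>, so the exponential factor and the common power of \<open>lam\<close> cancel.
  For \<open>i > 0\<close> the recurrence would read
  \<open>lam * upper_quot (Suc i) = real i * upper_quot i - 1\<close>, whose last term spoils an
  induction on signs; the series allows signs to be read off term by term.\<close>

lemma upper_quot_sums:
  "(\<lambda>r. lam ^ r * (fact n / fact (Suc n + r))) sums upper_quot (Suc n)"
proof -
  have "(\<lambda>r. pmf (poisson_pmf lam) (r + Suc n) / (real (Suc n) * pmf (poisson_pmf lam) (Suc n)))
      sums upper_quot (Suc n)"
    unfolding upper_quot_def by (intro sums_divide tail_sums)
  moreover have "pmf (poisson_pmf lam) (r + Suc n) / (real (Suc n) * pmf (poisson_pmf lam) (Suc n))
      = lam ^ r * (fact n / fact (Suc n + r))" for r
    unfolding pmf_poisson_Suc using lam by (simp add: power_add field_simps del: fact_Suc)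
  ultimately show ?thesis by simp
qed

lemma upper_quot_diff_sums:
  "(\<lambda>r. lam ^ r * (real (Suc r) * (fact n / fact (Suc (Suc n) + r))))
    sums (upper_quot (Suc n) - upper_quot (Suc (Suc n)))"
  using sums_diff[OF upper_quot_sums[of n] upper_quot_sums[of "Suc n"]]
  unfolding fact_quot_diff[symmetric] right_diff_distrib .

lemma upper_quot_less: "upper_quot (Suc (Suc i)) < upper_quot (Suc i)"
  using sums_pos[OF upper_quot_diff_sums[of i]] lam by simp

lemma upper_quot_convex: "upper_quot (i + 3) - 2 * upper_quot (i + 2) + upper_quot (i + 1) > 0"
proof -
  let ?b = "\<lambda>n r. lam ^ r * (real (Suc r) * (fact n / fact (Suc (Suc n) + r)))"
  have less: "?b (Suc i) r < ?b i r" for r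
  proof -
    have "(fact (Suc i) / fact (Suc (Suc (Suc i)) + r) :: real) < fact i / fact (Suc (Suc i) + r)"
    proof -
      \<comment> \<open>This is the right-hand side of \<open>fact_quot_diff\<close> at
        \<open>Suc r\<close>, that is, a second difference in \<open>i\<close> up to the factor
        \<open>Suc r\<close>.\<close>
      have "real (Suc (Suc r)) * (fact i / fact (Suc (Suc i) + Suc r)) > 0" by simp
      then show ?thesis unfolding fact_quot_diff[symmetric] by (simp del: fact_Suc)
    qed
    then show ?thesis using lam by (intro mult_strict_left_mono) auto
  qed
  have "(\<lambda>r. ?b i r - ?b (Suc i) r) sums
      ((upper_quot (Suc i) - upper_quot (Suc (Suc i)))
        - (upper_quot (Suc (Suc i)) - upper_quot (Suc (Suc (Suc i)))))"
    by (intro sums_diff upper_quot_diff_sums)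
  from sums_pos[OF this] less show ?thesis by (simp add: numeral_eq_Suc)
qed

section \<open>Closed forms of the Stein solution\<close>

lemma stein_solution_sum:
  assumes "stein_solution lam h f"
  shows "real i * pmf (poisson_pmf lam) i * f (int i)
    = (\<Sum>m<i. pmf (poisson_pmf lam) m * (h m - poisson_expect lam h))"
proof (induction i)
  case (Suc i)
  have stein: "h i - poisson_expect lam h = lam * f (int i + 1) - real i * f (int i)"
    using assms by (simp add: stein_solution_def)
  \<comment> \<open>The weight of \<open>f (i + 1)\<close> in the equation at \<open>i\<close>,
    multiplied by \<open>\<pi>\<^sub>i\<close>, equals its weight in the equation at
    \<open>i + 1\<close>, multiplied by the next probability: the sum telescopes.\<close>
  have "real (Suc i) * pmf (poisson_pmf lam) (Suc i) * f (int (Suc i))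
      = pmf (poisson_pmf lam) i * (lam * f (int i + 1))"
    unfolding pmf_poisson_Suc by (simp add: add.commute)
  also have "\<dots> = real i * pmf (poisson_pmf lam) i * f (int i)
      + pmf (poisson_pmf lam) i * (h i - poisson_expect lam h)"
    unfolding stein by (simp add: algebra_simps)
  finally show ?case using Suc by simp
qed simp

lemma stein_solution_lower:
  assumes "stein_solution lam (indicator {k..}) f" "i > 0" "i \<le> k"
  shows "f (int i) = - (1 - head k) * lower_quot i"
proof -
  have "real i * pmf (poisson_pmf lam) i * f (int i)
      = (\<Sum>m<i. pmf (poisson_pmf lam) m * - (1 - head k))"
    unfolding stein_solution_sum[OF assms(1)] poisson_expect_indicator
    using assms(3) by (intro sum.cong) auto
  also have "\<dots> = - (1 - head k) * head i"
    by (simp add: head_def sum_distrib_right[symmetric])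
  finally show ?thesis unfolding lower_quot_def
    using assms(2) pmf_poisson_pos[of i] by (simp add: field_simps)
qed

lemma sum_pmf_indicator:
  "i \<ge> k \<Longrightarrow> (\<Sum>m<i. pmf (poisson_pmf lam) m * indicator {k..} m) = head i - head k"
  by (induction rule: dec_induct) (auto simp: head_Suc intro!: sum.neutral)

text \<open>The range overlaps that of \<open>stein_solution_lower\<close> at \<open>i = k\<close>,
  so the differences on either side of \<open>k\<close> can each be computed from a single
  formula.\<close>

lemma stein_solution_upper:
  assumes "stein_solution lam (indicator {k..}) f" "i > 0" "i \<ge> k"
  shows "f (int i) = - head k * upper_quot i"
proof -
  have "real i * pmf (poisson_pmf lam) i * f (int i) = head i - head k - head i * (1 - head k)"
    unfolding stein_solution_sum[OF assms(1)] poisson_expect_indicator right_diff_distrib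
      sum_subtractf sum_pmf_indicator[OF assms(3)]
    by (simp add: head_def sum_distrib_right sum_subtractf right_diff_distrib)
  also have "\<dots> = - head k * (1 - head i)" by (simp add: algebra_simps)
  finally show ?thesis unfolding upper_quot_def
    using assms(2) pmf_poisson_pos[of i] by (simp add: field_simps)
qed

end

section \<open>Signs and monotonicity of the solution and its differences\<close>

theorem lemma4p1:
  fixes lam :: real and k :: nat and h :: "nat \<Rightarrow> real" and f :: "int \<Rightarrow> real"
  assumes "lam > 0"
    and "h = indicator {k..}"
    and "stein_solution lam h f"
  shows
    "sup_norm_on {0..} f = ereal (C0 lam k * poisson_expect lam h)
     \<and>
     (\<forall>i\<in>{0..int k - 1}. fwd_diff f i \<le> 0 \<and> (i \<ge> 1 \<longrightarrow> fwd_diff f i < 0)) \<and>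
     strict_antimono_on {0..int k - 1} (fwd_diff f) \<and>
     (\<forall>i\<in>{int k..}. fwd_diff f i \<ge> 0 \<and> (k \<ge> 1 \<longrightarrow> fwd_diff f i > 0)) \<and>
     antimono_on {int k..} (fwd_diff f) \<and>
     (k \<ge> 1 \<longrightarrow> strict_antimono_on {int k..} (fwd_diff f))
     \<and>
     sup_norm_on {0..int k - 1} (fwd_diff f) = ereal (C1_minus lam k * poisson_expect lam h) \<and>
     sup_norm_on {int k..} (fwd_diff f) = ereal (C1_plus lam k * poisson_expect lam h)
     \<and>
     sup_norm_on {0..} (fwd_diff f) = ereal (C1 lam k * poisson_expect lam h) \<and>
     sup_norm_on {0..} (fwd_diff (fwd_diff f)) = ereal (C2 lam k * poisson_expect lam h)"
proof (cases "k = 0")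
  case True
  \<comment> \<open>Here \<open>head 0 = 0\<close> kills \<open>f\<close> on the positive integers,
    and \<open>f 0 = f 1\<close> extends this to 0.\<close>
  have f: "f i = 0" if "i \<ge> 0" for i
  proof -
    have pos: "f (int n) = 0" if "n > 0" for n
      using stein_solution_upper[of lam 0 f n] assms True that
      by (simp add: head_0[OF assms(1)])
    moreover have "f 0 = f (int 1)" using assms(3) by (simp add: stein_solution_def)
    ultimately show ?thesis using that by (metis gr0I nonneg_int_cases of_nat_0 zero_less_one)
  qed
  have D: "fwd_diff f i = 0" if "i \<ge> 0" for i using f that by (simp add: fwd_diff_def)
  have DD: "fwd_diff (fwd_diff f) i = 0" if "i \<ge> 0" for i
    using D that by (simp add: fwd_diff_def[of "fwd_diff f"])
  have C: "C0 lam k = 0" "C1_minus lam k = 0" "C1_plus lam k = 0" "C1 lam k = 0" "C2 lam k = 0"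
    using True by (simp_all add: C0_def C1_minus_def C1_plus_def C1_def C2_def)
  have norm: "sup_norm_on {0..} g = ereal 0" if "\<And>i. i \<ge> 0 \<Longrightarrow> g i = 0" for g
    using that by (intro sup_norm_on_eqI[of 0]) auto
  \<comment> \<open>The index set is empty, so the value comes from the \<open>max 0\<close> in
    \<open>sup_norm_on\<close>.\<close>
  have "sup_norm_on {0..int k - 1} (fwd_diff f) = ereal 0"
    using True by (simp add: sup_norm_on_def bot_ereal_def zero_ereal_def)
  then show ?thesis
    using True D norm[OF f] norm[OF D] norm[OF DD] unfolding C
    by (auto simp: monotone_on_def)
next
  case False
  define p where "p = 1 - head lam k"
  define q where "q = head lam k"
  define L where "L = lower_quot lam"
  define U where "U = upper_quot lam"
  define D where "D = fwd_diff f"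
  have p: "p > 0" and q: "q > 0"
    using head_less_1[OF assms(1)] head_pos[OF assms(1)] False by (simp_all add: p_def q_def)
  have expect: "poisson_expect lam h = p"
    unfolding p_def assms(2) by (rule poisson_expect_indicator[OF assms(1)])
  have lower: "f (int i) = - p * L i" if "i > 0" "i \<le> k" for i
    using stein_solution_lower[of lam k f i] assms that by (simp add: p_def L_def)
  have upper: "f (int i) = - q * U i" if "i \<ge> k" for i
    using stein_solution_upper[of lam k f i] assms that False by (simp add: q_def U_def)
  have f0: "f 0 = f 1" using assms(3) by (simp add: stein_solution_def)

  \<comment> \<open>The convention \<open>f 0 = f 1\<close> makes the first difference 0, so strict
    negativity starts at 1; the step from 0 to 1 is still a strict decrease.\<close>
  have D0: "D 0 = 0" using f0 by (simp add: D_def fwd_diff_def)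
  have D_lower: "D (int i) = - p * (L (Suc i) - L i)" if "i > 0" "i < k" for i
    using lower[of i] lower[of "Suc i"] that
    by (simp add: D_def fwd_diff_def algebra_simps)
  have D_upper: "D (int i) = q * (U i - U (Suc i))" if "i \<ge> k" for i
    using upper[of i] upper[of "Suc i"] that
    by (simp add: D_def fwd_diff_def algebra_simps)
  have D_neg: "D i < 0" if "i \<ge> 1" "i \<le> int k - 1" for i
  proof -
    define n where "n = nat (i - 1)"
    have n: "i = int (Suc n)" using that by (simp add: n_def)
    then show ?thesis using D_lower[of "Suc n"] that p lower_quot_less[OF assms(1), of n]
      by (simp add: L_def mult_less_0_iff del: of_nat_Suc)
  qed
  have D_pos: "D i > 0" if "i \<ge> int k" for i
  proof -
    define n where "n = nat (i - 1)"
    have n: "i = int (Suc n)" using that False by (simp add: n_def)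
    then show ?thesis using D_upper[of "Suc n"] that q upper_quot_less[OF assms(1), of n]
      by (simp add: U_def del: of_nat_Suc)
  qed
  have D_nonpos: "D i \<le> 0" if "i \<ge> 0" "i \<le> int k - 1" for i
    using D_neg[of i] D0 that by (cases "i = 0") auto
  have DD_lower: "D (i + 1) < D i" if "i \<ge> 0" "i + 1 \<le> int k - 1" for i
  proof (cases "i = 0")
    case True
    then show ?thesis using D0 D_neg[of 1] that by simp
  next
    case False
    define n where "n = nat (i - 1)"
    have n: "i = int (Suc n)" using that False by (simp add: n_def)
    \<comment> \<open>This quantity is \<open>D i - D (i + 1)\<close>. Beyond \<open>k\<close> the
      same holds with \<open>q\<close> and \<open>U\<close>, so convexity yields decreasing
      differences on both sides.\<close>
    have "p * (L (n + 3) - 2 * L (n + 2) + L (n + 1)) > 0"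
      using p lower_quot_convex[OF assms(1), of n] by (simp add: L_def)
    then show ?thesis using D_lower[of "Suc n"] D_lower[of "Suc (Suc n)"] that n
      by (simp add: numeral_eq_Suc algebra_simps)
  qed
  have DD_upper: "D (i + 1) < D i" if "i \<ge> int k" for i
  proof -
    define n where "n = nat (i - 1)"
    have n: "i = int (Suc n)" using that False by (simp add: n_def)
    have "q * (U (n + 3) - 2 * U (n + 2) + U (n + 1)) > 0"
      using q upper_quot_convex[OF assms(1), of n] by (simp add: U_def)
    then show ?thesis using D_upper[of "Suc n"] D_upper[of "Suc (Suc n)"] that n
      by (simp add: numeral_eq_Suc algebra_simps)
  qed
  have D_strict_lower: "strict_antimono_on {0..int k - 1} D"
    using DD_lower by (intro monotone_on_int_stepI) (auto intro: transpI)
  have D_strict_upper: "strict_antimono_on {int k..} D"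
    using DD_upper by (intro monotone_on_int_stepI) (auto intro: transpI)
  have D_ge: "D (int k - 1) \<le> D i" if "i \<ge> 0" "i \<le> int k - 1" for i
    using monotone_onD[OF D_strict_lower, of i "int k - 1"] that by (cases "i = int k - 1") auto
  have D_le: "D i \<le> D (int k)" if "i \<ge> int k" for i
    using monotone_onD[OF D_strict_upper, of "int k" i] that by (cases "i = int k") auto

  \<comment> \<open>Signs of \<open>D\<close> up to \<open>k - 1\<close> control \<open>f\<close> up
    to \<open>k\<close>. Thus \<open>f\<close> falls until \<open>k\<close> and rises afterwards,
    with its minimum at \<open>k\<close>.\<close>
  have "monotone_on {0..int k} (<) (\<ge>) f"
    using D_nonpos
    by (intro monotone_on_int_stepI) (auto intro: transpI simp: D_def fwd_diff_def)
  then have f_lower: "f (int k) \<le> f i" if "i \<ge> 0" "i \<le> int k" for i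
    using monotone_onD[of "{0..int k}" "(<)" "(\<ge>)" f i "int k"] that by (cases "i = int k") auto
  have "monotone_on {int k..} (<) (\<le>) f"
    using D_pos
    by (intro monotone_on_int_stepI) (auto intro: transpI less_imp_le simp: D_def fwd_diff_def)
  then have f_upper: "f (int k) \<le> f i" if "i \<ge> int k" for i
    using monotone_onD[of "{int k..}" "(<)" "(\<le>)" f "int k" i] that by (cases "i = int k") auto
  have f_neg: "f i \<le> 0" if "i \<ge> 0" for i
  proof -
    have "f (int (Suc n)) \<le> 0" for n
      using lower[of "Suc n"] upper[of "Suc n"] p q
        lower_quot_pos[OF assms(1), of n] upper_quot_pos[OF assms(1), of n]
      by (cases "Suc n \<le> k") (auto simp: L_def U_def simp del: of_nat_Suc intro!: mult_nonneg_nonneg)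
    moreover have "f 0 = f (int (Suc 0))" using f0 by simp
    ultimately show ?thesis using that by (metis nonneg_int_cases of_nat_0 not0_implies_Suc)
  qed

  \<comment> \<open>The constants as values and differences of the solution near
    \<open>k\<close>\<close>
  have C0: "C0 lam k * p = - f (int k)"
    using lower[of k] False
    by (simp add: C0_def poisson_F_eq_head[OF assms(1)] L_def lower_quot_def[OF assms(1)])
  have step: "real (Suc i) * pmf (poisson_pmf lam) (Suc i) = lam * pmf (poisson_pmf lam) i" for i
    by (rule pmf_poisson_Suc[OF assms(1)])
  have pmf_pos: "pmf (poisson_pmf lam) i > 0" for i by (rule pmf_poisson_pos[OF assms(1)])
  have ratio_minus: "ratio_minus lam k * f (int k) = f (int k - 1)"
  proof (cases "k = 1")
    case True
    then show ?thesis using f0 by (simp add: ratio_minus_def)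
  next
    case k1: False
    obtain n where n: "k = Suc n" "n > 0" using False k1 by (cases k) auto
    have F: "poisson_F lam (int k - 2) = head lam n" "poisson_F lam (int k - 1) = head lam k"
      using poisson_F_eq_head[OF assms(1), of n] poisson_F_eq_head[OF assms(1), of k] n by simp_all
    \<comment> \<open>With \<open>k = n + 1\<close>, the denominator of \<open>L k\<close> is
      \<open>lam\<close> times the weight at \<open>n\<close>; the factors \<open>lam\<close> and
      \<open>head lam k\<close> cancel.\<close>
    have "head lam n / head lam k * (lam / real n) * L k = L n"
      unfolding L_def lower_quot_def[OF assms(1)] n(1) step
      using assms(1) pmf_pos[of n] n q by (simp add: q_def)
    then have "ratio_minus lam k * L k = L n"
      unfolding ratio_minus_def F using n k1 by simp
    moreover have "f (int k) = - p * L k" "f (int k - 1) = - p * L n"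
      using lower[of k] lower[of n] n by simp_all
    ultimately show ?thesis by simp
  qed
  have ratio_plus: "ratio_plus lam k * f (int k) = f (int k + 1)"
  proof -
    have F: "poisson_Fbar lam (int k + 1) = 1 - head lam (Suc k)"
        "poisson_Fbar lam (int k) = 1 - head lam k"
      using poisson_Fbar_eq_head[OF assms(1), of "Suc k"] poisson_Fbar_eq_head[OF assms(1), of k]
      by (simp_all add: add.commute)
    have "(1 - head lam (Suc k)) / (1 - head lam k) * (real k / lam) * U k = U (Suc k)"
      unfolding U_def upper_quot_def[OF assms(1)] step
      using assms(1) pmf_pos[of k] p False by (simp add: p_def)
    then have "ratio_plus lam k * U k = U (Suc k)"
      unfolding ratio_plus_def F by simp
    moreover have "f (int k) = - q * U k" "f (int k + 1) = - q * U (Suc k)"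
      using upper[of k] upper[of "Suc k"] by (simp_all add: add.commute)
    ultimately show ?thesis by simp
  qed
  have C1m: "C1_minus lam k * p = - D (int k - 1)"
  proof -
    have "C1_minus lam k * p = (C0 lam k * p) * (1 - ratio_minus lam k)" by (simp add: C1_minus_def)
    then show ?thesis unfolding C0 using ratio_minus by (simp add: D_def fwd_diff_def algebra_simps)
  qed
  have C1p: "C1_plus lam k * p = D (int k)"
  proof -
    have "C1_plus lam k * p = (C0 lam k * p) * (1 - ratio_plus lam k)" by (simp add: C1_plus_def)
    then show ?thesis unfolding C0 using ratio_plus by (simp add: D_def fwd_diff_def algebra_simps)
  qed
  have C2: "C2 lam k * p = D (int k) - D (int k - 1)"
    using C1m C1p by (simp add: C2_def C1_minus_def C1_plus_def algebra_simps)
  have C0_nonneg: "C0 lam k \<ge> 0"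
    using C0 f_neg[of "int k"] p by (metis neg_0_le_iff_le of_nat_0_le_iff zero_le_mult_iff not_less)
  \<comment> \<open>The nonnegative factor \<open>C0 lam k\<close> turns the minimum of the ratios
    into the maximum of the two one-sided constants.\<close>
  have "C1 lam k = max (C1_minus lam k) (C1_plus lam k)"
    using C0_nonneg
    by (auto simp: C1_def C1_minus_def C1_plus_def min_def max_def mult_le_cancel_left)
  then have C1: "C1 lam k * p = max (- D (int k - 1)) (D (int k))"
    using C1m C1p p by (simp add: max_mult_distrib_right)

  \<comment> \<open>Evaluation of the norms\<close>
  have norm_f: "sup_norm_on {0..} f = ereal (C0 lam k * p)"
    unfolding C0
  proof (rule sup_norm_on_eqI[of "int k"])
    fix j :: int assume "j \<in> {0..}"
    then show "\<bar>f j\<bar> \<le> \<bar>f (int k)\<bar>"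
      using f_neg[of j] f_neg[of "int k"] f_lower[of j] f_upper[of j] by (cases "j \<le> int k") auto
  qed (use f_neg[of "int k"] in auto)
  \<comment> \<open>Only a weak inequality at \<open>k - 1\<close>: for \<open>k = 1\<close> this is
    \<open>D 0 = 0\<close>.\<close>
  have last_nonpos: "D (int k - 1) \<le> 0" and at_k: "D (int k) > 0"
    using D_nonpos[of "int k - 1"] D_pos[of "int k"] False by auto
  have D_abs_lower: "\<bar>D j\<bar> \<le> - D (int k - 1)" if "0 \<le> j" "j \<le> int k - 1" for j
    using D_ge[OF that] D_nonpos[OF that] by simp
  have D_abs_upper: "\<bar>D j\<bar> \<le> D (int k)" if "int k \<le> j" for j
    using D_le[OF that] D_pos[OF that] by simp
  have norm_lower: "sup_norm_on {0..int k - 1} D = ereal (C1_minus lam k * p)"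
    unfolding C1m using D_abs_lower last_nonpos False
    by (intro sup_norm_on_eqI[of "int k - 1"]) auto
  have norm_upper: "sup_norm_on {int k..} D = ereal (C1_plus lam k * p)"
    unfolding C1p using D_abs_upper at_k
    by (intro sup_norm_on_eqI[of "int k"]) auto
  have norm_D: "sup_norm_on {0..} D = ereal (C1 lam k * p)"
  proof -
    have bound: "\<bar>D j\<bar> \<le> max (- D (int k - 1)) (D (int k))" if "j \<ge> 0" for j
      using D_abs_lower[of j] D_abs_upper[of j] that by (cases "j \<le> int k - 1") auto
    show ?thesis
    proof (cases "- D (int k - 1) \<le> D (int k)")
      case True
      then show ?thesis unfolding C1 using bound at_k
        by (intro sup_norm_on_eqI[of "int k"]) auto
    next
      case False
      then show ?thesis unfolding C1 using bound last_nonpos \<open>k \<noteq> 0\<close>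
        by (intro sup_norm_on_eqI[of "int k - 1"]) auto
    qed
  qed
  have norm_DD: "sup_norm_on {0..} (fwd_diff D) = ereal (C2 lam k * p)"
    unfolding C2
  proof (rule sup_norm_on_eqI[of "int k - 1"])
    fix j :: int assume j: "j \<in> {0..}"
    \<comment> \<open>The only upward jump of \<open>D\<close> is from \<open>k - 1\<close> to
      \<open>k\<close>, of size \<open>D k - D (k - 1)\<close>. A decrease before it is at most
      \<open>- D (k - 1)\<close>, and one after it is at most \<open>D k\<close>, because
      \<open>D\<close> keeps its sign on each side.\<close>
    consider "j + 1 \<le> int k - 1" | "j = int k - 1" | "j \<ge> int k" by linarith
    then show "\<bar>fwd_diff D j\<bar> \<le> \<bar>fwd_diff D (int k - 1)\<bar>"
    proof cases
      case 1
      then show ?thesis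
        using j DD_lower[of j] D_ge[of "j + 1"] D_nonpos[of j] last_nonpos at_k
        by (simp add: fwd_diff_def)
    next
      case 3
      then show ?thesis
        using DD_upper[of j] D_le[of j] D_pos[of "j + 1"] last_nonpos at_k
        by (simp add: fwd_diff_def)
    qed simp
  qed (use last_nonpos at_k False in \<open>auto simp: fwd_diff_def\<close>)

  have "antimono_on {int k..} D"
    using D_strict_upper by (auto simp: monotone_on_def order_le_less)
  then show ?thesis
    unfolding expect D_def[symmetric]
    using norm_f D_nonpos D_neg D_strict_lower D_pos D_strict_upper norm_lower norm_upper
      norm_D norm_DD
    by (auto intro: less_imp_le)
qed

end
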